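(* Let $\mathcal H$ be a Hilbert space with induced norm $\|\cdot\|$, $\mathcal A\subset\mathcal H$ a non-empty bounded set, and $f:\mathcal H\to\mathbb R$ an $L$-smooth convex function. Let $\alpha>0$, and fix an iteration $t>0$ with iterate $x_t$; let $z_t\in\mathcal A$ be the atom selected by the (approximate) linear minimization oracle for the direction $\nabla f(x_t)$. Let $x_{t+1}^{\mathrm{FW}_\alpha}$ be the new iterate of Frank-Wolfe using the set $\alpha\mathcal A=\{\alpha z:z\in\mathcal A\}$, and $x_{t+1}^{\mathrm{MP}}$ the new iterate of Matching Pursuit applied on the linear span of $\mathcal A$, both computed from $x_t$. Put $$\theta(f,x_t,\alpha):=-\frac{\langle\nabla f(x_t),\alpha z_t-x_t\rangle}{L\,\|\alpha z_t-x_t\|^2}.$$ (i) If $\theta(f,x_t,\alpha)\le1$, then $x_{t+1}^{\mathrm{FW}_\alpha}$ converges to $x_{t+1}^{\mathrm{MP}}$ with rate $\|x_{t+1}^{\mathrm{FW}_\alpha}-x_{t+1}^{\mathrm{MP}}\|\in O(1/\alpha)$. (ii) In particular, when $\alpha$ grows to infinity, the condition $\theta(f,x_t,\alpha)\le1$ always holds (for all steps $t$). (iii) Otherwise (if $\theta(f,x_t,\alpha)>1$), the difference of the iterates satisfies $\|x_{t+1}^{\mathrm{FW}_\alpha}-x_{t+1}^{\mathrm{MP}}\|\in O(\alpha)$.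
   Context: $L$-smooth: $f$ is (Fréchet) differentiable with $\|\nabla f(x)-\nabla f(y)\|\le L\|x-y\|$. Let $g_{x_t}(x):=f(x_t)+\langle\nabla f(x_t),x-x_t\rangle+\frac L2\|x-x_t\|^2$. The $O(\cdot)$ notation is in $\alpha$, with $f$, $x_t$ and $z_t$ fixed. Oracle: with quality parameter $\delta\in(0,1]$ ($\delta=1$ being the exact oracle), the approximate oracle for Matching Pursuit returns $z_t\in\mathcal A$ with $\langle\nabla f(x_t),z_t\rangle\le\delta\min_{z\in\mathcal A}\langle\nabla f(x_t),z\rangle$; for Frank-Wolfe on a set $\mathcal D$ it returns $\tilde z\in\mathcal D$ with $\langle\nabla f(x_t),\tilde z-x_t\rangle\le\delta\min_{z\in\mathcal D}\langle\nabla f(x_t),z-x_t\rangle$. The same $z_t$ is used in both steps below, the Frank-Wolfe atom in $\alpha\mathcal A$ being $\alpha z_t$. Scaling: throughout, $\alpha\ge\rho/\delta$, where $\rho>0$ is an upper bound on the atomic norms $\|x\|_{\mathcal A}:=\inf\{c>0:x\in c\cdot\operatorname{conv}(\mathcal A)\}$ of the iterates and of a minimizer $x^\star$ of $f$ over the linear span of $\mathcal A$. Frank-Wolfe step on $\alpha\mathcal A$: $x_{t+1}^{\mathrm{FW}_\alpha}:=x_t+\gamma(\alpha z_t-x_t)$ with $\gamma=\arg\min_{\gamma\in[0,1]}g_{x_t}(x_t+\gamma(\alpha z_t-x_t))$; that is, $x_{t+1}^{\mathrm{FW}_\alpha}=x_t+\theta(f,x_t,\alpha)(\alpha z_t-x_t)$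 if $\theta(f,x_t,\alpha)\le1$, and $x_{t+1}^{\mathrm{FW}_\alpha}=\alpha z_t$ otherwise. Matching Pursuit step: $x_{t+1}^{\mathrm{MP}}:=x_t+\gamma z_t$ with $\gamma=\arg\min_{\gamma\in\mathbb R}g_{x_t}(x_t+\gamma z_t)$; that is, $x_{t+1}^{\mathrm{MP}}=x_t-\frac{\langle\nabla f(x_t),z_t\rangle}{L\|z_t\|^2}z_t$. *)

theory Defs
  imports "HOL-Analysis.Analysis" "HOL-Library.Landau_Symbols"
begin

text \<open>A Hilbert space is a type of sort \<open>{real_inner, complete_space}\<close>. On such a space a Frechet
  differentiable function has a (unique) gradient at every point, by the Riesz representation
  theorem.\<close>

definition gradient :: "('a::real_inner \<Rightarrow> real) \<Rightarrow> 'a \<Rightarrow> 'a" where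
  "gradient f x = (THE D. GDERIV f x :> D)"

definition L_smooth :: "real \<Rightarrow> ('a::real_inner \<Rightarrow> real) \<Rightarrow> bool" where
  "L_smooth L f \<longleftrightarrow>
     (\<forall>x. f differentiable (at x)) \<and>
     (\<forall>x y. norm (gradient f x - gradient f y) \<le> L * norm (x - y))"

text \<open>The atomic norm takes the value \<open>\<infinity>\<close> on points that lie in no positive multiple of the
  convex hull of \<open>A\<close>.\<close>

definition atomic_norm :: "'a::real_vector set \<Rightarrow> 'a \<Rightarrow> ereal" where
  "atomic_norm A x = (INF c \<in> {c. 0 < c \<and> x \<in> (\<lambda>a. c *\<^sub>R a) ` (convex hull A)}. ereal c)"

text \<open>The minimum over \<open>A\<close> is taken as an infimum, since \<open>A\<close> need not be compact; it is finite
  because \<open>A\<close> is bounded and non-empty wherever this is used.\<close>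

definition approx_lmo :: "real \<Rightarrow> 'a::real_inner set \<Rightarrow> 'a \<Rightarrow> 'a \<Rightarrow> bool" where
  "approx_lmo \<delta> A d z \<longleftrightarrow> z \<in> A \<and> inner d z \<le> \<delta> * (INF a\<in>A. inner d a)"

definition quad_model :: "('a::real_inner \<Rightarrow> real) \<Rightarrow> real \<Rightarrow> 'a \<Rightarrow> 'a \<Rightarrow> real" where
  "quad_model f L x y = f x + inner (gradient f x) (y - x) + L / 2 * (norm (y - x))\<^sup>2"

definition \<theta> :: "('a::real_inner \<Rightarrow> real) \<Rightarrow> real \<Rightarrow> 'a \<Rightarrow> 'a \<Rightarrow> real \<Rightarrow> real" where
  "\<theta> f L x z \<alpha> =
     - inner (gradient f x) (\<alpha> *\<^sub>R z - x) / (L * (norm (\<alpha> *\<^sub>R z - x))\<^sup>2)"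

text \<open>The two steps in closed form; \<open>mp_step_iff_arg_min\<close> and \<open>fw_step_iff_arg_min\<close> below show
  that they are the minimizers of the quadratic model over the line and the segment. For the
  segment this needs \<open>\<theta> \<ge> 0\<close>; when \<open>\<theta> < 0\<close>, \<open>fw_step\<close> follows the closed form without clipping at
  0. At the one degenerate scale with \<open>\<alpha> *\<^sub>R z = x\<close>, \<open>\<theta>\<close> is 0 and the step stays at \<open>x\<close>.\<close>

definition mp_step :: "('a::real_inner \<Rightarrow> real) \<Rightarrow> real \<Rightarrow> 'a \<Rightarrow> 'a \<Rightarrow> 'a" where
  "mp_step f L x z = x - (inner (gradient f x) z / (L * (norm z)\<^sup>2)) *\<^sub>R z"

definition fw_step :: "('a::real_inner \<Rightarrow> real) \<Rightarrow> real \<Rightarrow> 'a \<Rightarrow> 'a \<Rightarrow> real \<Rightarrow> 'a" where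
  "fw_step f L x z \<alpha> =
     (if \<theta> f L x z \<alpha> \<le> 1 then x + \<theta> f L x z \<alpha> *\<^sub>R (\<alpha> *\<^sub>R z - x) else \<alpha> *\<^sub>R z)"

lemma quad_model_line:
  assumes "L > 0" "d \<noteq> 0"
  shows "quad_model f L x (x + \<gamma> *\<^sub>R d) =
    f x - (inner (gradient f x) d)\<^sup>2 / (2 * L * (norm d)\<^sup>2)
    + L / 2 * (norm d)\<^sup>2 * (\<gamma> - (- inner (gradient f x) d / (L * (norm d)\<^sup>2)))\<^sup>2"
  using assms
  by (simp add: quad_model_def power_mult_distrib field_simps power2_eq_square)

lemma is_arg_min_quad_model:
  assumes "L > 0" "d \<noteq> 0"
  shows "is_arg_min (\<lambda>\<gamma>. quad_model f L x (x + \<gamma> *\<^sub>R d)) P \<gamma> \<longleftrightarrow>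
    is_arg_min (\<lambda>\<gamma>. \<bar>\<gamma> - (- inner (gradient f x) d / (L * (norm d)\<^sup>2))\<bar>) P \<gamma>"
proof -
  have "quad_model f L x (x + r *\<^sub>R d) < quad_model f L x (x + s *\<^sub>R d) \<longleftrightarrow>
    \<bar>r - (- inner (gradient f x) d / (L * (norm d)\<^sup>2))\<bar>
      < \<bar>s - (- inner (gradient f x) d / (L * (norm d)\<^sup>2))\<bar>" for r s
    unfolding quad_model_line[OF assms] linorder_not_le[symmetric] abs_le_square_iff
    using assms by (simp add: mult_le_cancel_left_pos)
  then show ?thesis
    by (simp add: is_arg_min_def)
qed

lemma mp_step_iff_arg_min:
  assumes "L > 0" "z \<noteq> 0"
  shows "y = mp_step f L x z \<longleftrightarrow>
    (\<exists>\<gamma>. is_arg_min (\<lambda>\<gamma>. quad_model f L x (x + \<gamma> *\<^sub>R z)) (\<lambda>_. True) \<gamma> \<and> y = x + \<gamma> *\<^sub>R z)"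
proof -
  have arg: "is_arg_min (\<lambda>\<gamma>. \<bar>\<gamma> - c\<bar>) (\<lambda>_. True) \<gamma> \<longleftrightarrow> \<gamma> = c" for c \<gamma> :: real
    by (auto simp: is_arg_min_def dest: spec[of _ c])
  show ?thesis
    unfolding is_arg_min_quad_model[OF assms] arg by (simp add: mp_step_def)
qed

lemma fw_step_iff_arg_min:
  assumes "L > 0" "0 \<le> \<theta> f L x z \<alpha>"
  shows "y = fw_step f L x z \<alpha> \<longleftrightarrow>
    (\<exists>\<gamma>. is_arg_min (\<lambda>\<gamma>. quad_model f L x (x + \<gamma> *\<^sub>R (\<alpha> *\<^sub>R z - x))) (\<lambda>\<gamma>. \<gamma> \<in> {0..1}) \<gamma> \<and>
         y = x + \<gamma> *\<^sub>R (\<alpha> *\<^sub>R z - x))"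
proof (cases "\<alpha> *\<^sub>R z - x = 0")
  case True
  then show ?thesis
    by (auto simp: fw_step_def \<theta>_def is_arg_min_def intro!: exI[of _ 0])
next
  case False
  have arg: "is_arg_min (\<lambda>\<gamma>. \<bar>\<gamma> - c\<bar>) (\<lambda>\<gamma>. \<gamma> \<in> {0..1}) \<gamma> \<longleftrightarrow> \<gamma> = min c 1"
    if "0 \<le> c" for c \<gamma> :: real
  proof
    assume *: "is_arg_min (\<lambda>\<gamma>. \<bar>\<gamma> - c\<bar>) (\<lambda>\<gamma>. \<gamma> \<in> {0..1}) \<gamma>"
    then have "\<gamma> \<in> {0..1}"
      by (simp add: is_arg_min_def)
    moreover have "min c 1 \<in> {0..1}"
      using that by simp
    then have "\<not> \<bar>min c 1 - c\<bar> < \<bar>\<gamma> - c\<bar>"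
      using * unfolding is_arg_min_def by blast
    ultimately show "\<gamma> = min c 1"
      by (auto simp: min_def abs_if split: if_splits)
  qed (use that in \<open>auto simp: is_arg_min_def\<close>)
  show ?thesis
    unfolding is_arg_min_quad_model[OF assms(1) False] \<theta>_def[symmetric] arg[OF assms(2)]
    by (simp add: fw_step_def min_def)
qed

text \<open>The oracle and the scaling give \<open>\<theta> \<ge> 0\<close>, as required in \<open>fw_step_iff_arg_min\<close>, as soon as
  the linear minimum is nonpositive (e.g. for symmetric \<open>A\<close>, or for \<open>0\<close> in the closed convex
  hull of \<open>A\<close>).\<close>

lemma inner_ge_atomic_norm:
  assumes "bounded A" "atomic_norm A x \<le> ereal \<rho>" "(INF a\<in>A. inner d a) \<le> 0"
  shows "\<rho> * (INF a\<in>A. inner d a) \<le> inner d x"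
proof -
  let ?m = "INF a\<in>A. inner d a"
  have "bounded (inner d ` A)"
    using assms(1) bounded_linear_image bounded_linear_inner_right by blast
  then have "?m \<le> inner d a" if "a \<in> A" for a
    using that by (intro cINF_lower bounded_imp_bdd_below)
  then have "convex hull A \<subseteq> {a. inner d a \<ge> ?m}"
    by (intro hull_minimal convex_halfspace_ge) auto
  moreover have "\<exists>c b. 0 < c \<and> c < \<rho> + e \<and> b \<in> convex hull A \<and> x = c *\<^sub>R b" if "e > 0" for e
  proof -
    have "atomic_norm A x < ereal (\<rho> + e)"
      using assms(2) that by (metis ereal_less_eq(3) less_add_same_cancel1 linorder_not_le order_trans)
    then show ?thesis
      unfolding atomic_norm_def INF_less_iff by auto
  qed
  ultimately have step: "(\<rho> + e) * ?m \<le> inner d x" if "e > 0" for e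
  proof -
    obtain c b where c: "0 < c" "c < \<rho> + e" "b \<in> convex hull A" "x = c *\<^sub>R b"
      and b: "?m \<le> inner d b"
      using \<open>\<And>e. 0 < e \<Longrightarrow> \<exists>c b. 0 < c \<and> c < \<rho> + e \<and> b \<in> convex hull A \<and> x = c *\<^sub>R b\<close>
        \<open>convex hull A \<subseteq> {a. inner d a \<ge> ?m}\<close> \<open>e > 0\<close> by blast
    have "(\<rho> + e) * ?m \<le> c * ?m"
      using c assms(3) by (intro mult_right_mono_neg) auto
    also have "\<dots> \<le> inner d x"
      using c b by simp
    finally show ?thesis .
  qed
  have "((\<lambda>e. (\<rho> + e) * ?m) \<longlongrightarrow> (\<rho> + 0) * ?m) (at_right 0)"
    by (intro tendsto_intros)
  then have "(\<rho> + 0) * ?m \<le> inner d x"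
    by (rule tendsto_upperbound) (auto intro: step eventually_at_right_less eventually_mono)
  then show ?thesis
    by simp
qed

lemma \<theta>_nonneg:
  assumes "L > 0" "0 < \<delta>" "0 < \<rho>" "\<rho> / \<delta> \<le> \<alpha>" "bounded A"
    and "atomic_norm A x \<le> ereal \<rho>" "approx_lmo \<delta> A (gradient f x) z"
    and "(INF a\<in>A. inner (gradient f x) a) \<le> 0"
  shows "0 \<le> \<theta> f L x z \<alpha>"
proof -
  let ?m = "INF a\<in>A. inner (gradient f x) a"
  have "0 < \<alpha>" "\<rho> \<le> \<alpha> * \<delta>"
    using assms(2-4) by (auto simp: field_simps intro: less_le_trans[OF divide_pos_pos])
  have "\<alpha> * inner (gradient f x) z \<le> \<alpha> * (\<delta> * ?m)"
    using assms(7) \<open>0 < \<alpha>\<close> by (intro mult_left_mono) (auto simp: approx_lmo_def)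
  also have "\<dots> = (\<alpha> * \<delta>) * ?m"
    by simp
  also have "\<dots> \<le> \<rho> * ?m"
    using \<open>\<rho> \<le> \<alpha> * \<delta>\<close> assms(8) by (rule mult_right_mono_neg)
  also have "\<dots> \<le> inner (gradient f x) x"
    using assms(5,6,8) by (rule inner_ge_atomic_norm)
  finally show ?thesis
    using assms(1) by (simp add: \<theta>_def inner_diff_right divide_nonpos_nonneg)
qed

end

theory Submission
  imports Defs
begin

text \<open>Writing \<open>P\<^sub>u g = (g \<bullet> u) u\<close> with \<open>u\<close> the normalized direction, the unclipped Frank-Wolfe step
  and the Matching Pursuit step are both \<open>x - P\<^sub>u (\<nabla>f x) / L\<close>, for \<open>u\<close> the direction of
  \<open>\<alpha> z - x\<close> and of \<open>z\<close>, respectively. These two unit vectors differ by at most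
  \<open>2 \<parallel>x\<parallel> / (\<alpha> \<parallel>z\<parallel>)\<close>, which gives the rate \<open>1 / \<alpha>\<close> for every \<open>\<alpha> > 0\<close>. Since
  \<open>\<bar>\<theta>\<bar> \<le> \<parallel>\<nabla>f x\<parallel> / (L \<parallel>\<alpha> z - x\<parallel>)\<close>, clipping does not occur for large \<open>\<alpha>\<close>; a clipped step ends
  at \<open>\<alpha> z\<close>, whose norm is linear in \<open>\<alpha>\<close>.\<close>

text \<open>Multiplied by \<open>norm w\<close>, the difference splits into a rescaling of
  \<open>sgn v\<close> and \<open>v - w\<close>; the reverse triangle inequality bounds each by
  \<open>norm (v - w)\<close>. The convention \<open>sgn 0 = 0\<close> covers
  \<open>v = 0\<close>.\<close>

lemma norm_sgn_diff_le:
  fixes v w :: "'a::real_normed_vector"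
  assumes "w \<noteq> 0"
  shows "norm (sgn v - sgn w) \<le> 2 * norm (v - w) / norm w"
proof -
  have "norm w *\<^sub>R (sgn v - sgn w) = (norm w - norm v) *\<^sub>R sgn v + (v - w)"
    using assms by (cases "v = 0") (simp_all add: sgn_div_norm algebra_simps)
  then have "norm w * norm (sgn v - sgn w) = norm ((norm w - norm v) *\<^sub>R sgn v + (v - w))"
    by (metis abs_norm_cancel norm_scaleR)
  also have "\<dots> \<le> \<bar>norm w - norm v\<bar> * norm (sgn v) + norm (v - w)"
    by (metis norm_scaleR norm_triangle_ineq)
  also have "\<dots> \<le> norm (v - w) * 1 + norm (v - w)"
    using norm_triangle_ineq3[of w v]
    by (intro add_mono mult_mono) (simp_all add: norm_sgn norm_minus_commute)
  finally show ?thesis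
    using assms by (simp add: pos_le_divide_eq mult.commute)
qed

text \<open>Change one of the two occurrences of the vector at a time, as in the product rule.
  Assuming norms at most 1 rather than equal to 1 admits \<open>sgn 0\<close>.\<close>

lemma norm_inner_scaleR_diff_le:
  fixes d u v :: "'a::real_inner"
  assumes "norm u \<le> 1" "norm v \<le> 1"
  shows "norm (inner d u *\<^sub>R u - inner d v *\<^sub>R v) \<le> 2 * norm d * norm (u - v)"
proof -
  have "inner d u *\<^sub>R u - inner d v *\<^sub>R v = inner d u *\<^sub>R (u - v) + inner d (u - v) *\<^sub>R v"
    by (simp add: algebra_simps inner_diff_right)
  then have "norm (inner d u *\<^sub>R u - inner d v *\<^sub>R v)
      \<le> \<bar>inner d u\<bar> * norm (u - v) + \<bar>inner d (u - v)\<bar> * norm v"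
    by (metis norm_scaleR norm_triangle_ineq)
  also have "\<dots> \<le> (norm d * norm u) * norm (u - v) + (norm d * norm (u - v)) * norm v"
    by (intro add_mono mult_right_mono Cauchy_Schwarz_ineq2) auto
  also have "\<dots> \<le> (norm d * 1) * norm (u - v) + (norm d * norm (u - v)) * 1"
    using assms by (intro add_mono mult_mono) auto
  finally show ?thesis
    by simp
qed

lemma mp_step_eq_sgn:
  "mp_step f L x z = x - (1 / L) *\<^sub>R (inner (gradient f x) (sgn z) *\<^sub>R sgn z)"
  by (simp add: mp_step_def sgn_div_norm power2_eq_square field_simps)

text \<open>Both sides minimize the same quadratic model along the line through \<open>x\<close>
  with direction \<open>\<alpha> *\<^sub>R z - x\<close>; if that direction is 0, both are
  \<open>x\<close>.\<close>

lemma \<theta>_step_eq_mp_step: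
  "x + \<theta> f L x z \<alpha> *\<^sub>R (\<alpha> *\<^sub>R z - x) = mp_step f L x (\<alpha> *\<^sub>R z - x)"
  by (simp add: \<theta>_def mp_step_def)

lemma norm_\<theta>_step_diff_mp_step_le:
  assumes "L > 0" "\<alpha> > 0" "z \<noteq> 0"
  shows "norm (x + \<theta> f L x z \<alpha> *\<^sub>R (\<alpha> *\<^sub>R z - x) - mp_step f L x z)
    \<le> 4 * norm (gradient f x) * norm x / (L * norm z) * (1 / \<alpha>)"
proof -
  let ?d = "gradient f x" and ?v = "\<alpha> *\<^sub>R z - x"
  \<comment> \<open>Comparing \<open>?v\<close> with \<open>\<alpha> *\<^sub>R z\<close> instead of
    \<open>z\<close> leaves the fixed difference \<open>- x\<close>, while the denominator
    \<open>\<alpha> * norm z\<close> supplies the rate.\<close>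
  have sgn_z: "sgn (\<alpha> *\<^sub>R z) = sgn z"
    using assms(2) by (simp add: sgn_scaleR)
  have "x + \<theta> f L x z \<alpha> *\<^sub>R ?v - mp_step f L x z
      = - (1 / L) *\<^sub>R (inner ?d (sgn ?v) *\<^sub>R sgn ?v - inner ?d (sgn z) *\<^sub>R sgn z)"
    unfolding \<theta>_step_eq_mp_step mp_step_eq_sgn by (simp add: algebra_simps)
  then have "norm (x + \<theta> f L x z \<alpha> *\<^sub>R ?v - mp_step f L x z)
      = (1 / L) * norm (inner ?d (sgn ?v) *\<^sub>R sgn ?v - inner ?d (sgn z) *\<^sub>R sgn z)"
    using assms(1) by (simp only: norm_scaleR) simp
  also have "\<dots> \<le> (1 / L) * (2 * norm ?d * norm (sgn ?v - sgn z))"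
    using assms(1) by (intro mult_left_mono norm_inner_scaleR_diff_le) (auto simp: norm_sgn)
  also have "\<dots> \<le> (1 / L) * (2 * norm ?d * (2 * norm x / (\<alpha> * norm z)))"
    using assms norm_sgn_diff_le[of "\<alpha> *\<^sub>R z" ?v]
    by (intro mult_left_mono) (auto simp: sgn_z)
  finally show ?thesis
    by (simp add: mult_ac)
qed

lemma filterlim_norm_scaleR_diff_at_top:
  fixes x z :: "'a::real_normed_vector"
  assumes "z \<noteq> 0"
  shows "filterlim (\<lambda>\<alpha>. norm (\<alpha> *\<^sub>R z - x)) at_top at_top"
proof (rule filterlim_at_top_mono)
  have "filterlim (\<lambda>\<alpha>. - norm x + \<alpha> * norm z) at_top at_top"
    using assms
    by (intro filterlim_tendsto_add_at_top[OF tendsto_const]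
        filterlim_at_top_mult_tendsto_pos[OF tendsto_const _ filterlim_ident]) auto
  then show "filterlim (\<lambda>\<alpha>. \<alpha> * norm z - norm x) at_top at_top"
    by simp
  show "\<forall>\<^sub>F \<alpha> in at_top. \<alpha> * norm z - norm x \<le> norm (\<alpha> *\<^sub>R z - x)"
    using eventually_ge_at_top[of 0]
  proof eventually_elim
    case (elim \<alpha>)
    then show ?case
      using norm_triangle_ineq2[of "\<alpha> *\<^sub>R z" x] by simp
  qed
qed

lemma eventually_\<theta>_le_1:
  assumes "L > 0" "z \<noteq> 0"
  shows "\<forall>\<^sub>F \<alpha> in at_top. \<theta> f L x z \<alpha> \<le> 1"
proof -
  have "\<forall>\<^sub>F \<alpha> in at_top. norm (gradient f x) / L \<le> norm (\<alpha> *\<^sub>R z - x)"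
    using filterlim_norm_scaleR_diff_at_top[OF assms(2)] by (simp add: filterlim_at_top)
  then show ?thesis
  proof eventually_elim
    case (elim \<alpha>)
    let ?v = "\<alpha> *\<^sub>R z - x"
    have "- inner (gradient f x) ?v \<le> norm (gradient f x) * norm ?v"
      using Cauchy_Schwarz_ineq2[of "gradient f x" ?v] by linarith
    also have "\<dots> \<le> (L * norm ?v) * norm ?v"
      using elim assms(1) by (intro mult_right_mono) (auto simp: field_simps)
    finally have "- inner (gradient f x) ?v \<le> L * (norm ?v)\<^sup>2"
      by (simp add: power2_eq_square mult.assoc)
    \<comment> \<open>If \<open>?v = 0\<close>, division by zero makes \<open>\<theta>\<close> equal
      to 0.\<close>
    then show ?case
      using assms(1) by (cases "?v = 0") (simp_all add: \<theta>_def pos_le_divide_eq)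
  qed
qed

text \<open>Both O-bounds use a principal filter, so one constant serves every admissible scale. For
  clipped steps this matters: by the second claim their scales are bounded, and a bound only as
  \<alpha> tends to infinity would be vacuous.\<close>

theorem theorem14:
  fixes f :: "'a::{real_inner, complete_space} \<Rightarrow> real"
    and A :: "'a set"
    and x z :: "nat \<Rightarrow> 'a"
    and x_star :: 'a
    and L \<delta> \<rho> :: real
    and t :: nat
  assumes "A \<noteq> {}" "bounded A"
    and "L > 0" "L_smooth L f" "convex_on UNIV f"
    and "0 < \<delta>" "\<delta> \<le> 1"
    and "\<And>s. approx_lmo \<delta> A (gradient f (x s)) (z s)"
    and "x_star \<in> span A" "\<And>y. y \<in> span A \<Longrightarrow> f x_star \<le> f y"
    and "\<rho> > 0" "\<And>s. atomic_norm A (x s) \<le> ereal \<rho>" "atomic_norm A x_star \<le> ereal \<rho>"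
    and "t > 0" "z t \<noteq> 0"
  shows "(((\<lambda>\<alpha>. fw_step f L (x t) (z t) \<alpha>) \<longlongrightarrow> mp_step f L (x t) (z t))
            (inf at_top (principal {\<alpha>. \<rho> / \<delta> \<le> \<alpha> \<and> \<theta> f L (x t) (z t) \<alpha> \<le> 1})) \<and>
          (\<lambda>\<alpha>. norm (fw_step f L (x t) (z t) \<alpha> - mp_step f L (x t) (z t)))
            \<in> O[principal {\<alpha>. \<rho> / \<delta> \<le> \<alpha> \<and> \<theta> f L (x t) (z t) \<alpha> \<le> 1}](\<lambda>\<alpha>. 1 / \<alpha>))
       \<and> (\<forall>s. z s \<noteq> 0 \<longrightarrow> (\<forall>\<^sub>F \<alpha> in at_top. \<theta> f L (x s) (z s) \<alpha> \<le> 1))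
       \<and> (\<lambda>\<alpha>. norm (fw_step f L (x t) (z t) \<alpha> - mp_step f L (x t) (z t)))
            \<in> O[principal {\<alpha>. \<rho> / \<delta> \<le> \<alpha> \<and> \<theta> f L (x t) (z t) \<alpha> > 1}](\<lambda>\<alpha>. \<alpha>)"
proof (intro conjI allI impI)
  let ?S = "{\<alpha>. \<rho> / \<delta> \<le> \<alpha> \<and> \<theta> f L (x t) (z t) \<alpha> \<le> 1}"
  let ?C = "4 * norm (gradient f (x t)) * norm (x t) / (L * norm (z t))"
  have pos: "\<rho> / \<delta> > 0"
    using assms by simp
  have bound: "norm (fw_step f L (x t) (z t) \<alpha> - mp_step f L (x t) (z t)) \<le> ?C * (1 / \<alpha>)"
    if "\<alpha> \<in> ?S" for \<alpha>
    using norm_\<theta>_step_diff_mp_step_le[OF assms(3) _ assms(15), of \<alpha> "x t" f] that pos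
    by (simp add: fw_step_def)
  show "(\<lambda>\<alpha>. norm (fw_step f L (x t) (z t) \<alpha> - mp_step f L (x t) (z t)))
      \<in> O[principal ?S](\<lambda>\<alpha>. 1 / \<alpha>)"
    using bound pos by (intro bigoI[of _ ?C]) (auto simp: eventually_principal)
  show "((\<lambda>\<alpha>. fw_step f L (x t) (z t) \<alpha>) \<longlongrightarrow> mp_step f L (x t) (z t))
      (inf at_top (principal ?S))"
  proof (rule LIM_zero_cancel, rule Lim_null_comparison)
    show "\<forall>\<^sub>F \<alpha> in inf at_top (principal ?S).
        norm (fw_step f L (x t) (z t) \<alpha> - mp_step f L (x t) (z t)) \<le> ?C * (1 / \<alpha>)"
      using bound by (simp add: eventually_inf_principal)
    have "((\<lambda>\<alpha>. ?C * (1 / \<alpha>)) \<longlongrightarrow> ?C * 0) at_top"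
      by (intro tendsto_mult tendsto_const tendsto_divide_0[OF tendsto_const]
          filterlim_at_top_imp_at_infinity filterlim_ident)
    then show "((\<lambda>\<alpha>. ?C * (1 / \<alpha>)) \<longlongrightarrow> 0) (inf at_top (principal ?S))"
      by (intro tendsto_mono[OF inf_le1]) simp
  qed
  show "\<forall>\<^sub>F \<alpha> in at_top. \<theta> f L (x s) (z s) \<alpha> \<le> 1" if "z s \<noteq> 0" for s
    using assms(3) that by (rule eventually_\<theta>_le_1)
  let ?T = "{\<alpha>. \<rho> / \<delta> \<le> \<alpha> \<and> \<theta> f L (x t) (z t) \<alpha> > 1}"
  let ?m = "mp_step f L (x t) (z t)"
  have "norm (fw_step f L (x t) (z t) \<alpha> - ?m) \<le> (norm (z t) + norm ?m / (\<rho> / \<delta>)) * \<alpha>"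
    if "\<alpha> \<in> ?T" for \<alpha>
  proof -
    have "\<alpha> > 0" "\<rho> / \<delta> \<le> \<alpha>"
      using that pos by auto
    have "norm (fw_step f L (x t) (z t) \<alpha> - ?m) \<le> \<alpha> * norm (z t) + norm ?m"
      using that \<open>\<alpha> > 0\<close> norm_triangle_ineq4[of "\<alpha> *\<^sub>R z t" ?m] by (simp add: fw_step_def)
    \<comment> \<open>The lower bound \<open>\<rho> / \<delta>\<close> on the scale turns the
      constant \<open>norm ?m\<close> into a multiple of \<alpha>.\<close>
    also have "norm ?m \<le> norm ?m / (\<rho> / \<delta>) * \<alpha>"
      using mult_left_mono[OF \<open>\<rho> / \<delta> \<le> \<alpha>\<close> norm_ge_zero[of ?m]] pos
      by (simp only: times_divide_eq_left pos_le_divide_eq)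
    finally show ?thesis
      by (simp add: algebra_simps)
  qed
  then show "(\<lambda>\<alpha>. norm (fw_step f L (x t) (z t) \<alpha> - ?m)) \<in> O[principal ?T](\<lambda>\<alpha>. \<alpha>)"
    using pos
    by (intro bigoI[of _ "norm (z t) + norm ?m / (\<rho> / \<delta>)"]) (auto simp: eventually_principal)
qed

end
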